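(* Let $a,b,c$ be positive integers and $m$ a non-negative even number. Then the Kauffman bracket polynomial of the pretzel diagram $D(m;a,b,c)$ is $$\left\langle D(m;a,b,c)\right\rangle = A^{3m+a+b+c}\,\delta^{-4}\Big(\left(F_a+\delta^2\right)\left(F_b+\delta^2\right)\left(F_c+\delta^2\right)+(-A^{-4})^m(\delta^2-1)F_aF_bF_c\Big),$$ where $\delta=-A^2-A^{-2}$ and $F_i=(-A^{-4})^i-1$.
   Context: The variable $A$ is an indeterminate, and identities are in the field of rational functions in $A$. Kauffman bracket: for an unoriented link diagram $D$ let $\mathcal{C}(D)$ be its set of crossings. A state of $D$ is a function $s:\mathcal{C}(D)\to\{-1,+1\}$; $\mathcal{S}(D)$ is the set of states. For a state $s$, $sD$ is the diagram obtained from $D$ by nullifying (smoothing) every crossing $c$ as follows: rotate the picture so that the over-strand at $c$ runs from lower left to upper right (and the under-strand from upper left to lower right). If $s(c)=+1$, replace the crossing by two arcs, one joining the upper-left end to the lower-left end and one joining the upper-right end to the lower-right end; if $s(c)=-1$, replace it by two arcs, one joining the two upper ends and one joining the two lower ends. Let $|sD|$ be the number of connected components (closed curves) of $sD$, and set $\langle D|s\rangle = A^{\sum_{c\in\mathcal{C}(D)}s(c)}(-A^2-A^{-2})^{|sD|-1}$. The Kauffman bracket polynomial is $\langle D\rangle=\sum_{s\in\mathcal{S}(D)}\langle D|s\rangle$. Pretzel diagrams: for positive integers $p_1,\dots,p_n$, $D(p_1,\dots,p_n)$ is the standard pretzel diagram consisting of $n$ vertical columns placed from left to right, the $i$-th column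 being two vertical strands twisted around each other with $p_i$ crossings stacked vertically, where at every crossing the over-strand runs from lower left to upper right. For $1\le i<n$ the upper-right end of column $i$ is joined to the upper-left end of column $i+1$ and the lower-right end of column $i$ to the lower-left end of column $i+1$; the upper-left end of column $1$ is joined to the upper-right end of column $n$ by an arc passing above everything, and the lower-left end of column $1$ is joined to the lower-right end of column $n$ by an arc passing below everything. For $m\ge 0$, $D(m;p_1,\dots,p_n)$ denotes $D(1,\dots,1,p_1,\dots,p_n)$ with $m$ initial entries equal to $1$; in particular $D(0;p_1,\dots,p_n)=D(p_1,\dots,p_n)$. *)

theory Defs
  imports
    "HOL-Computational_Algebra.Fraction_Field"
    "HOL-Computational_Algebra.Polynomial"
    "HOL-Library.FuncSet"
    "HOL-Library.Disjoint_Sets"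
begin

section \<open>Unoriented link diagrams\<close>

text \<open>
  A diagram is recorded by its gluing data. Around each crossing, rotated so that the over-strand
  runs from lower left to upper right, there are four ends. There are two such rotations; they
  differ by a half turn, which exchanges \<open>UL\<close> with \<open>LR\<close> and \<open>UR\<close> with \<open>LL\<close> and preserves
  both smoothings below. The strands running between crossings are the two-element sets of the
  ends that they connect, and closed curves without any crossing are only counted.
  Everything below depends on the gluing data alone; whether the data come from a picture in
  the plane (as those of a pretzel diagram do) is immaterial to the state sum and is not required.
\<close>

datatype corner = UL | UR | LL | LR

record 'c diagram =
  crossings :: "'c set"
  arcs :: "('c \<times> corner) set set"
  free_circles :: nat

definition ends :: "'c diagram \<Rightarrow> ('c \<times> corner) set" where
  "ends D = crossings D \<times> UNIV"

definition wf_diagram :: "'c diagram \<Rightarrow> bool" where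
  "wf_diagram D \<longleftrightarrow>
     finite (crossings D) \<and> partition_on (ends D) (arcs D) \<and> (\<forall>e\<in>arcs D. card e = 2)"


section \<open>Smoothings and the Kauffman bracket\<close>

definition states :: "'c diagram \<Rightarrow> ('c \<Rightarrow> int) set" where
  "states D = crossings D \<rightarrow>\<^sub>E {- 1, 1}"

definition smoothing_arcs :: "int \<Rightarrow> 'c \<Rightarrow> ('c \<times> corner) set set" where
  "smoothing_arcs i c =
     (if i = 1 then {{(c, UL), (c, LL)}, {(c, UR), (c, LR)}}
      else {{(c, UL), (c, UR)}, {(c, LL), (c, LR)}})"

definition smoothed_arcs :: "'c diagram \<Rightarrow> ('c \<Rightarrow> int) \<Rightarrow> ('c \<times> corner) set set" where
  "smoothed_arcs D s = arcs D \<union> (\<Union>c\<in>crossings D. smoothing_arcs (s c) c)"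

definition same_curve :: "'c diagram \<Rightarrow> ('c \<Rightarrow> int) \<Rightarrow> (('c \<times> corner) \<times> ('c \<times> corner)) set" where
  "same_curve D s =
     {(x, y). {x, y} \<in> smoothed_arcs D s}\<^sup>* \<inter> (ends D \<times> ends D)"

definition num_curves :: "'c diagram \<Rightarrow> ('c \<Rightarrow> int) \<Rightarrow> nat" where
  "num_curves D s = card (ends D // same_curve D s) + free_circles D"

definition indet :: "rat poly fract"  ("\<A>") where
  "\<A> = Fraction_Field.Fract [:0, 1:] 1"

definition loop_value :: "rat poly fract"  ("\<delta>") where
  "\<delta> = - (\<A> ^ 2) - \<A> powi (- 2)"

definition state_bracket :: "'c diagram \<Rightarrow> ('c \<Rightarrow> int) \<Rightarrow> rat poly fract" where
  "state_bracket D s =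
     \<A> powi (\<Sum>c\<in>crossings D. s c) *
     \<delta> powi (int (num_curves D s) - 1)"

definition kauffman_bracket :: "'c diagram \<Rightarrow> rat poly fract" where
  "kauffman_bracket D = (\<Sum>s\<in>states D. state_bracket D s)"


section \<open>Pretzel diagrams\<close>

text \<open>
  The crossing \<open>(i, j)\<close> is the \<open>j\<close>-th one, counted from the top, in the \<open>i\<close>-th column from the
  left, both counted from 0. The list of column heights must be nonempty and its entries positive.
\<close>

definition pretzel_crossings :: "nat list \<Rightarrow> (nat \<times> nat) set" where
  "pretzel_crossings ps = {(i, j). i < length ps \<and> j < ps ! i}"

definition top_crossing :: "nat \<Rightarrow> nat \<times> nat" where
  "top_crossing i = (i, 0)"

definition bottom_crossing :: "nat list \<Rightarrow> nat \<Rightarrow> nat \<times> nat" where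
  "bottom_crossing ps i = (i, ps ! i - 1)"

definition column_arcs :: "nat list \<Rightarrow> ((nat \<times> nat) \<times> corner) set set" where
  "column_arcs ps =
     (\<Union>i\<in>{i. i < length ps}. \<Union>j\<in>{j. Suc j < ps ! i}.
        {{((i, j), LL), ((i, Suc j), UL)}, {((i, j), LR), ((i, Suc j), UR)}})"

definition joining_arcs :: "nat list \<Rightarrow> ((nat \<times> nat) \<times> corner) set set" where
  "joining_arcs ps =
     (\<Union>i\<in>{i. Suc i < length ps}.
        {{(top_crossing i, UR), (top_crossing (Suc i), UL)},
         {(bottom_crossing ps i, LR), (bottom_crossing ps (Suc i), LL)}})"

definition closing_arcs :: "nat list \<Rightarrow> ((nat \<times> nat) \<times> corner) set set" where
  "closing_arcs ps =
     {{(top_crossing 0, UL), (top_crossing (length ps - 1), UR)},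
      {(bottom_crossing ps 0, LL), (bottom_crossing ps (length ps - 1), LR)}}"

definition pretzel :: "nat list \<Rightarrow> (nat \<times> nat) diagram" where
  "pretzel ps =
     \<lparr>crossings = pretzel_crossings ps,
      arcs = column_arcs ps \<union> joining_arcs ps \<union> closing_arcs ps,
      free_circles = 0\<rparr>"

definition pretzel_ones :: "nat \<Rightarrow> nat list \<Rightarrow> (nat \<times> nat) diagram" where
  "pretzel_ones m ps = pretzel (replicate m 1 @ ps)"

definition F :: "nat \<Rightarrow> rat poly fract" where
  "F i = (- (\<A> powi (- 4))) ^ i - 1"

lemma finite_pretzel_crossings: "finite (pretzel_crossings ps)"
proof -
  have "pretzel_crossings ps = (SIGMA i:{..<length ps}. {..<ps ! i})"
    by (auto simp: pretzel_crossings_def)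
  then show ?thesis by simp
qed

lemma wf_diagram_pretzel:
  assumes ne: "ps \<noteq> []" and pos: "\<And>p. p \<in> set ps \<Longrightarrow> p > 0"
  shows "wf_diagram (pretzel ps)"
proof -
  let ?n = "length ps"
  define E where "E = column_arcs ps \<union> joining_arcs ps \<union> closing_arcs ps"
  have p: "ps ! i > 0" if "i < ?n" for i
    using pos that by simp
  have n: "?n > 0" using ne by simp
  note defs = E_def column_arcs_def joining_arcs_def closing_arcs_def
    top_crossing_def bottom_crossing_def
  have card2: "\<forall>e\<in>E. card e = 2"
    by (auto simp: defs card_insert_if)
  have sub: "e \<subseteq> pretzel_crossings ps \<times> UNIV" if "e \<in> E" for e
    using that p n by (auto simp: defs pretzel_crossings_def)
  define partner :: "(nat \<times> nat) \<times> corner \<Rightarrow> (nat \<times> nat) \<times> corner" where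
    "partner = (\<lambda>((i, j), k). case k of
       UL \<Rightarrow> if j > 0 then ((i, j - 1), LL)
             else if i > 0 then ((i - 1, 0), UR) else ((?n - 1, 0), UR)
     | UR \<Rightarrow> if j > 0 then ((i, j - 1), LR)
             else if Suc i < ?n then ((Suc i, 0), UL) else ((0, 0), UL)
     | LL \<Rightarrow> if Suc j < ps ! i then ((i, Suc j), UL)
             else if i > 0 then ((i - 1, ps ! (i - 1) - 1), LR)
             else ((?n - 1, ps ! (?n - 1) - 1), LR)
     | LR \<Rightarrow> if Suc j < ps ! i then ((i, Suc j), UR)
             else if Suc i < ?n then ((Suc i, ps ! Suc i - 1), LL)
             else ((0, ps ! 0 - 1), LL))"
  have partner: "e = {x, partner x}" if "e \<in> E" "x \<in> e" for e x
    using that p n by (auto simp: defs partner_def insert_commute)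
  have col: "{((i, j), LL), ((i, Suc j), UL)} \<in> E" "{((i, j), LR), ((i, Suc j), UR)} \<in> E"
    if "i < ?n" "Suc j < ps ! i" for i j
    using that unfolding E_def column_arcs_def by blast+
  have join: "{((i, 0), UR), ((Suc i, 0), UL)} \<in> E"
      "{((i, ps ! i - 1), LR), ((Suc i, ps ! Suc i - 1), LL)} \<in> E"
    if "Suc i < ?n" for i
    using that unfolding E_def joining_arcs_def top_crossing_def bottom_crossing_def by blast+
  have clos: "{((0, 0), UL), ((?n - 1, 0), UR)} \<in> E"
      "{((0, ps ! 0 - 1), LL), ((?n - 1, ps ! (?n - 1) - 1), LR)} \<in> E"
    unfolding E_def closing_arcs_def top_crossing_def bottom_crossing_def by blast+
  have cover: "{x, partner x} \<in> E" if x: "x \<in> pretzel_crossings ps \<times> UNIV" for x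
  proof -
    obtain i j k where xe: "x = ((i, j), k)" by (metis surj_pair)
    have i: "i < ?n" and j: "j < ps ! i"
      using x xe by (auto simp: pretzel_crossings_def)
    have last: "i = ?n - 1" if "\<not> Suc i < ?n" using that i by simp
    have bot: "j = ps ! i - 1" if "\<not> Suc j < ps ! i" using that j by simp
    show ?thesis
    proof (cases k)
      case UL
      consider j' where "j = Suc j'" | i' where "j = 0" "i = Suc i'" | "j = 0" "i = 0"
        by (metis not0_implies_Suc)
      then show ?thesis
      proof cases
        case 1
        then show ?thesis using col(1)[of i j'] UL xe i j
          by (simp add: partner_def insert_commute)
      next
        case 2
        then show ?thesis using join(1)[of i'] UL xe i
          by (simp add: partner_def insert_commute)
      next
        case 3
        then show ?thesis using clos(1) UL xe by (simp add: partner_def)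
      qed
    next
      case UR
      consider j' where "j = Suc j'" | "j = 0" "Suc i < ?n" | "j = 0" "\<not> Suc i < ?n"
        by (metis not0_implies_Suc)
      then show ?thesis
      proof cases
        case 1
        then show ?thesis using col(2)[of i j'] UR xe i j
          by (simp add: partner_def insert_commute)
      next
        case 2
        then show ?thesis using join(1)[of i] UR xe by (simp add: partner_def)
      next
        case 3
        then show ?thesis using clos(1) last UR xe by (simp add: partner_def insert_commute)
      qed
    next
      case LL
      consider "Suc j < ps ! i" | i' where "\<not> Suc j < ps ! i" "i = Suc i'"
        | "\<not> Suc j < ps ! i" "i = 0"
        by (metis not0_implies_Suc)
      then show ?thesis
      proof cases
        case 1
        then show ?thesis using col(1)[of i j] LL xe i by (simp add: partner_def)
      next
        case 2
        then show ?thesis using join(2)[of i'] bot LL xe i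
          by (simp add: partner_def insert_commute)
      next
        case 3
        then show ?thesis using clos(2) bot LL xe by (simp add: partner_def)
      qed
    next
      case LR
      consider "Suc j < ps ! i" | "\<not> Suc j < ps ! i" "Suc i < ?n"
        | "\<not> Suc j < ps ! i" "\<not> Suc i < ?n"
        by blast
      then show ?thesis
      proof cases
        case 1
        then show ?thesis using col(2)[of i j] LR xe i by (simp add: partner_def)
      next
        case 2
        then show ?thesis using join(2)[of i] bot LR xe by (simp add: partner_def)
      next
        case 3
        then show ?thesis using clos(2) bot last LR xe by (simp add: partner_def insert_commute)
      qed
    qed
  qed
  have "partition_on (pretzel_crossings ps \<times> UNIV) E"
  proof (rule partition_onI)
    show "\<Union> E = pretzel_crossings ps \<times> UNIV"
      using sub cover by blast
    show "disjnt e e'" if "e \<in> E" "e' \<in> E" "e \<noteq> e'" for e e'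
      using partner that unfolding disjnt_def by blast
    show "{} \<notin> E"
      using card2 by fastforce
  qed
  then show ?thesis
    using card2 finite_pretzel_crossings
    by (simp add: wf_diagram_def ends_def pretzel_def E_def)
qed

end

theory Submission
  imports Defs
begin

text \<open>
  A column of \<open>p\<close> crossings in a given state is, up to small circles, one of two pieces: two
  vertical strands if every crossing is smoothed with sign \<open>1\<close>, and otherwise a cap and a cup
  with \<open>k - 1\<close> circles between them, where \<open>k\<close> is the number of signs \<open>- 1\<close>. By the binomial
  theorem, the states of the second kind contribute
  \<open>A\<^sup>p ((1 + A\<^sup>-\<^sup>2 \<delta>)\<^sup>p - 1) / \<delta>\<close>; since \<open>1 + A\<^sup>-\<^sup>2 \<delta> = - A\<^sup>-\<^sup>4\<close>, this is
  \<open>A\<^sup>p F\<^sub>p / \<delta>\<close>. The only state of the first kind contributes \<open>A\<^sup>p\<close>.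

  The columns are arranged in a ring. If \<open>v > 0\<close> of them are vertical, the ring closes up into \<open>v\<close>
  curves besides the small circles, one in each gap between consecutive vertical columns. If none
  is vertical, there are two curves, one along the tops and one along the bottoms. Apart from
  this exception each vertical column counts for a factor \<open>\<delta>\<close>, so that the state sum
  factorises over the columns up to a correction by the states without vertical columns:
  \<open>A\<^sup>\<Sigma>\<^sup>p (\<delta>\<^sup>-\<^sup>1 \<Prod>(F\<^sub>p / \<delta> + \<delta>) + (\<delta> - \<delta>\<^sup>-\<^sup>1) \<Prod>(F\<^sub>p / \<delta>))\<close>.
  This is \<open>kauffman_bracket_pretzel\<close>, valid for every pretzel diagram. For a column of height \<open>1\<close>
  one has \<open>F\<^sub>1 / \<delta> = A\<^sup>-\<^sup>2\<close> and \<open>F\<^sub>1 / \<delta> + \<delta> = - A\<^sup>2\<close>, and the parity of \<open>m\<close> removes the sign of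
  the \<open>m\<close>-th power of the latter.

  The geometric part is the number of curves, \<open>num_curves_pretzel\<close>. Each end is sent to a
  distinguished end of its curve by a map that is constant along every arc; the curves are then
  counted by the values of this map.
\<close>

section \<open>Counting classes and cyclic induction\<close>

text \<open>
  A map that is constant along \<open>R\<close> and moves every point within its own component takes exactly
  one value on each component.
\<close>

lemma card_quotient_rtrancl_retract:
  assumes sym: "sym R" and closed: "r ` X \<subseteq> X"
    and inv: "\<And>x y. (x, y) \<in> R \<Longrightarrow> r x = r y"
    and retract: "\<And>x. x \<in> X \<Longrightarrow> (x, r x) \<in> R\<^sup>*"
  shows "card (X // (R\<^sup>* \<inter> X \<times> X)) = card (r ` X)"
proof -
  let ?E = "R\<^sup>* \<inter> X \<times> X"
  have inv': "r x = r y" if "(x, y) \<in> R\<^sup>*" for x y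
    using that by induction (auto dest: inv)
  have symR: "(y, x) \<in> R\<^sup>*" if "(x, y) \<in> R\<^sup>*" for x y
    using that sym_rtrancl[OF sym] by (auto dest: symD)
  have cls: "?E `` {x} = {y \<in> X. r y = r x}" if "x \<in> X" for x
    using that inv' retract symR by (auto intro: rtrancl_trans) (metis retract rtrancl_trans symR)
  have "X // ?E = (\<lambda>z. {y \<in> X. r y = z}) ` r ` X"
    using cls by (auto simp: quotient_def)
  moreover have "inj_on (\<lambda>z. {y \<in> X. r y = z}) (r ` X)"
    by (rule inj_onI) blast
  ultimately show ?thesis by (simp add: card_image)
qed

lemma cyclic_induct:
  fixes n :: nat
  assumes base: "k < n" "P k" and step: "\<And>i. i < n \<Longrightarrow> P i \<Longrightarrow> P (Suc i mod n)" and i: "i < n"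
  shows "P i"
proof -
  have "P ((k + d) mod n)" for d
  proof (induction d)
    case 0
    then show ?case using base by simp
  next
    case (Suc d)
    have "(k + d) mod n < n" using i by simp
    from step[OF this Suc.IH] show ?case by (simp add: mod_Suc_eq)
  qed
  from this[of "n + i - k"] show ?thesis using base i by simp
qed

section \<open>Ends of a column by level and side\<close>

datatype side = L | R

fun upper :: "side \<Rightarrow> corner" where "upper L = UL" | "upper R = UR"
fun lower :: "side \<Rightarrow> corner" where "lower L = LL" | "lower R = LR"

text \<open>
  A column of \<open>p\<close> crossings has the levels \<open>0, \<dots>, p\<close>, with crossing \<open>j\<close> between the levels
  \<open>j\<close> and \<open>j + 1\<close>. At an inner level two ends on the same side meet along a column arc; the node
  there is the one of them that belongs to the upper crossing. This contracts all the column arcs.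
\<close>

definition node :: "nat \<Rightarrow> nat \<Rightarrow> side \<Rightarrow> (nat \<times> nat) \<times> corner" where
  "node i l d = (case l of 0 \<Rightarrow> ((i, 0), upper d) | Suc j \<Rightarrow> ((i, j), lower d))"

lemma node_simps [simp]:
  "node i 0 d = ((i, 0), upper d)" "node i (Suc j) d = ((i, j), lower d)"
  by (simp_all add: node_def)

section \<open>The curves of a pretzel state\<close>

locale pretzel_state =
  fixes ps :: "nat list" and s :: "nat \<times> nat \<Rightarrow> int"
  assumes nonempty: "ps \<noteq> []"
    and positive: "\<And>i. i < length ps \<Longrightarrow> 0 < ps ! i"
    and is_state: "s \<in> states (pretzel ps)"
begin

abbreviation "n \<equiv> length ps"

definition link :: "(((nat \<times> nat) \<times> corner) \<times> ((nat \<times> nat) \<times> corner)) set" where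
  "link = {(x, y). {x, y} \<in> smoothed_arcs (pretzel ps) s}"

abbreviation joined (infix "\<sim>" 50) where "x \<sim> y \<equiv> (x, y) \<in> link\<^sup>*"

definition horizontal :: "nat \<Rightarrow> nat \<Rightarrow> bool" where
  "horizontal i j \<longleftrightarrow> j < ps ! i \<and> s (i, j) = - 1"

definition straight :: "nat \<Rightarrow> bool" where
  "straight i \<longleftrightarrow> (\<forall>j. \<not> horizontal i j)"

lemma n_pos: "0 < n" using nonempty by simp

lemma sign_cases: "i < n \<Longrightarrow> j < ps ! i \<Longrightarrow> \<not> horizontal i j \<Longrightarrow> s (i, j) = 1"
  using is_state by (auto simp: states_def pretzel_def pretzel_crossings_def horizontal_def PiE_iff)

lemma sym_link: "sym link"
  by (auto simp: link_def sym_def insert_commute)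

lemma joined_sym: "x \<sim> y \<Longrightarrow> y \<sim> x"
  using sym_rtrancl[OF sym_link] by (auto dest: symD)

lemmas joined_trans = rtrancl_trans[where r = link]

lemma linkI: "{x, y} \<in> smoothed_arcs (pretzel ps) s \<Longrightarrow> x \<sim> y"
  by (auto simp: link_def)

lemma upper_end_joined:
  assumes "i < n" "j < ps ! i"
  shows "((i, j), upper d) \<sim> node i j d"
proof (cases j)
  case (Suc j')
  have "{((i, j'), lower d), ((i, j), upper d)} \<in> column_arcs ps"
    unfolding column_arcs_def using assms Suc by (cases d) auto
  then have "((i, j'), lower d) \<sim> ((i, j), upper d)"
    by (intro linkI) (simp add: smoothed_arcs_def pretzel_def)
  then show ?thesis using Suc by (simp add: joined_sym)
qed simp

lemma smoothing_joined:
  assumes "i < n" "j < ps ! i" "{x, y} \<in> smoothing_arcs (s (i, j)) (i, j)"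
  shows "x \<sim> y"
  using assms by (intro linkI) (auto simp: smoothed_arcs_def pretzel_def pretzel_crossings_def)

lemma vertical_joined:
  assumes "i < n" "j < ps ! i" "\<not> horizontal i j"
  shows "node i j d \<sim> node i (Suc j) d"
proof -
  have "((i, j), upper d) \<sim> ((i, j), lower d)"
    using assms sign_cases[OF assms]
    by (intro smoothing_joined) (cases d; auto simp: smoothing_arcs_def)+
  with upper_end_joined[OF assms(1,2), of d] show ?thesis
    by (auto intro: joined_trans joined_sym)
qed

lemma horizontal_joined:
  assumes "i < n" "horizontal i j"
  shows "node i j L \<sim> node i j R" "node i (Suc j) L \<sim> node i (Suc j) R"
proof -
  have j: "j < ps ! i" and "s (i, j) = - 1" using assms by (auto simp: horizontal_def)
  then have "((i, j), UL) \<sim> ((i, j), UR)" "((i, j), LL) \<sim> ((i, j), LR)"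
    using assms by (auto intro!: smoothing_joined simp: smoothing_arcs_def)
  moreover note upper_end_joined[OF assms(1) j, of L] upper_end_joined[OF assms(1) j, of R]
  ultimately show "node i j L \<sim> node i j R" "node i (Suc j) L \<sim> node i (Suc j) R"
    by (auto intro: joined_trans joined_sym)
qed

lemma strand_joined:
  assumes "i < n" "l \<le> l'" "l' \<le> ps ! i" "\<And>j. l \<le> j \<Longrightarrow> j < l' \<Longrightarrow> \<not> horizontal i j"
  shows "node i l d \<sim> node i l' d"
  using assms(2-4)
proof (induction l' rule: dec_induct)
  case (step k)
  then show ?case using vertical_joined[of i k d] assms(1) by (auto intro: joined_trans)
qed simp

lemma top_joined:
  assumes "i < n"
  shows "node i 0 R \<sim> node (Suc i mod n) 0 L"
proof (cases "Suc i < n")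
  case True
  then have "{((i, 0), UR), ((Suc i, 0), UL)} \<in> joining_arcs ps"
    by (auto simp: joining_arcs_def top_crossing_def)
  then show ?thesis using True by (intro linkI) (simp add: smoothed_arcs_def pretzel_def)
next
  case False
  then have "Suc i = n" using assms by simp
  then have "i = n - 1" "Suc i mod n = 0" by auto
  moreover have "{((n - 1, 0), UR), ((0, 0), UL)} \<in> closing_arcs ps"
    by (auto simp: closing_arcs_def top_crossing_def insert_commute)
  ultimately show ?thesis by (intro linkI) (simp add: smoothed_arcs_def pretzel_def)
qed

lemma bottom_node: "i < n \<Longrightarrow> node i (ps ! i) d = (bottom_crossing ps i, lower d)"
  using positive[of i] by (cases "ps ! i") (auto simp: bottom_crossing_def)

lemma bottom_joined:
  assumes "i < n"
  shows "node i (ps ! i) R \<sim> node (Suc i mod n) (ps ! (Suc i mod n)) L"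
proof (cases "Suc i < n")
  case True
  then have "{(bottom_crossing ps i, LR), (bottom_crossing ps (Suc i), LL)} \<in> joining_arcs ps"
    by (auto simp: joining_arcs_def)
  then show ?thesis using True assms
    by (intro linkI) (simp add: smoothed_arcs_def pretzel_def bottom_node)
next
  case False
  then have "Suc i = n" using assms by simp
  then have "i = n - 1" "Suc i mod n = 0" by auto
  moreover have "{(bottom_crossing ps (n - 1), LR), (bottom_crossing ps 0, LL)} \<in> closing_arcs ps"
    by (auto simp: closing_arcs_def insert_commute)
  ultimately show ?thesis using assms n_pos
    by (intro linkI) (simp add: smoothed_arcs_def pretzel_def bottom_node)
qed

text \<open>
  The two strands descend from the top to the first horizontally smoothed crossing, whose upper
  arc joins them to a cap. The cup at the bottom arises in the same way from the last such crossing.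
\<close>

lemma top_crossed:
  assumes "i < n" "\<not> straight i"
  shows "node i 0 L \<sim> node i 0 R"
proof -
  define j where "j = (LEAST j. horizontal i j)"
  have j: "horizontal i j" "\<And>j'. j' < j \<Longrightarrow> \<not> horizontal i j'"
    using assms(2) unfolding j_def straight_def by (auto intro: LeastI dest: not_less_Least)
  have "node i 0 d \<sim> node i j d" for d
    using j assms(1) by (intro strand_joined) (auto simp: horizontal_def)
  with horizontal_joined(1)[OF assms(1) j(1)] show ?thesis
    by (meson joined_sym joined_trans)
qed

lemma finite_horizontal: "finite {j. horizontal i j}"
  by (rule finite_subset[of _ "{..<ps ! i}"]) (auto simp: horizontal_def)

lemma bottom_crossed:
  assumes "i < n" "\<not> straight i"
  shows "node i (ps ! i) L \<sim> node i (ps ! i) R"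
proof -
  define j where "j = Max {j. horizontal i j}"
  have ne: "{j. horizontal i j} \<noteq> {}" using assms(2) by (auto simp: straight_def)
  have j: "horizontal i j" using Max_in[OF finite_horizontal ne] by (simp add: j_def)
  have above: "\<not> horizontal i j'" if "Suc j \<le> j'" for j'
    using Max_ge[OF finite_horizontal, of j' i] that by (auto simp: j_def)
  have "node i (Suc j) d \<sim> node i (ps ! i) d" for d
    using j above assms(1) by (intro strand_joined) (auto simp: horizontal_def)
  with horizontal_joined(2)[OF assms(1) j(1)] show ?thesis
    by (meson joined_sym joined_trans)
qed

text \<open>
  \<open>last_straight i\<close> is the nearest straight column strictly to the left of column \<open>i\<close> in the cyclic
  order, provided that there is a straight column; the maximum at \<open>0\<close> accounts for the wrap-around
  from the first column to the last.
\<close>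

primrec last_straight :: "nat \<Rightarrow> nat" where
  "last_straight 0 = Max {i. i < n \<and> straight i}"
| "last_straight (Suc i) = (if straight i then i else last_straight i)"

definition some_straight :: bool where
  "some_straight \<longleftrightarrow> (\<exists>i<n. straight i)"

lemma last_straight_in:
  assumes "some_straight" "i \<le> n"
  shows "last_straight i < n \<and> straight (last_straight i)"
  using assms(2)
proof (induction i)
  case 0
  have "Max {i. i < n \<and> straight i} \<in> {i. i < n \<and> straight i}"
    using assms(1) by (intro Max_in) (auto simp: some_straight_def)
  then show ?case by simp
qed auto

lemma last_straight_cyclic:
  assumes some_straight
  shows "last_straight n = last_straight 0"
proof -
  let ?w = "Max {i. i < n \<and> straight i}"
  have w: "?w < n" "straight ?w" using last_straight_in[OF assms, of 0] by auto
  have "last_straight i = ?w" if "Suc ?w \<le> i" "i \<le> n" for i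
    using that
  proof (induction i rule: dec_induct)
    case base
    then show ?case using w by simp
  next
    case (step k)
    have "\<not> straight k"
    proof
      assume "straight k"
      then have "k \<le> ?w" using step by (intro Max_ge) auto
      with step show False by simp
    qed
    then show ?case using step by simp
  qed
  then show ?thesis using w by simp
qed

text \<open>
  The distinguished ends of the curves through the upper left end (\<open>top_rep\<close>) and the lower left
  end (\<open>bottom_rep\<close>) of column \<open>i\<close>. Going left from there, caps and cups are passed until the right
  strand of a straight column is met. If there is no straight column, tops and bottoms stay on
  two different curves. Representatives of small circles will always be lower left ends, so the
  choice of a right end for the lower curve keeps the two kinds visibly apart.
\<close>

definition top_rep :: "nat \<Rightarrow> (nat \<times> nat) \<times> corner" where
  "top_rep i = (if some_straight then node (last_straight i) 0 R else node 0 0 L)"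

definition bottom_rep :: "nat \<Rightarrow> (nat \<times> nat) \<times> corner" where
  "bottom_rep i = (if some_straight then node (last_straight i) 0 R else node 0 (ps ! 0) R)"

text \<open>
  Passing column \<open>i\<close> to the right, a curve continues through a cap or a cup, or a new one begins at
  the right strand. That this holds also from the last column to the first is what makes the
  representatives consistent with the closing arcs.
\<close>

lemma rep_step:
  assumes "i < n"
  shows "top_rep (Suc i mod n) = (if straight i then node i 0 R else top_rep i)"
    and "bottom_rep (Suc i mod n) = (if straight i then node i 0 R else bottom_rep i)"
proof -
  have "last_straight (Suc i mod n) = last_straight (Suc i)" if some_straight
    using last_straight_cyclic[OF that] assms by (cases "Suc i = n") auto
  moreover have "some_straight" if "straight i" using that assms by (auto simp: some_straight_def)
  ultimately show "top_rep (Suc i mod n) = (if straight i then node i 0 R else top_rep i)"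
    "bottom_rep (Suc i mod n) = (if straight i then node i 0 R else bottom_rep i)"
    by (auto simp: top_rep_def bottom_rep_def)
qed

lemma straight_reps_eq: "i < n \<Longrightarrow> straight i \<Longrightarrow> bottom_rep i = top_rep i"
  by (auto simp: top_rep_def bottom_rep_def some_straight_def)

lemma straight_joined:
  "i < n \<Longrightarrow> straight i \<Longrightarrow> l \<le> ps ! i \<Longrightarrow> node i l d \<sim> node i 0 d"
  by (rule joined_sym, rule strand_joined) (auto simp: straight_def)

text \<open>
  One step to the right along the tops. If column \<open>i\<close> is straight, the next representative is its
  own upper right end; a straight column thus serves as a starting point for the induction around
  the ring.
\<close>

lemma top_rep_step:
  assumes "i < n" "straight i \<or> node i 0 L \<sim> top_rep i"
  shows "node (Suc i mod n) 0 L \<sim> top_rep (Suc i mod n)"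
proof -
  have "node i 0 R \<sim> top_rep (Suc i mod n)"
    using assms top_crossed[OF assms(1)] rep_step(1)[OF assms(1)]
    by (metis joined_sym joined_trans rtrancl.rtrancl_refl)
  with top_joined[OF assms(1)] show ?thesis by (meson joined_sym joined_trans)
qed

lemma bottom_rep_step:
  assumes "i < n" "straight i \<or> node i (ps ! i) L \<sim> bottom_rep i"
  shows "node (Suc i mod n) (ps ! (Suc i mod n)) L \<sim> bottom_rep (Suc i mod n)"
proof -
  have "node i (ps ! i) R \<sim> bottom_rep (Suc i mod n)"
    using assms bottom_crossed[OF assms(1)] rep_step(2)[OF assms(1)] straight_joined
    by (metis joined_sym joined_trans order_refl)
  with bottom_joined[OF assms(1)] show ?thesis by (meson joined_sym joined_trans)
qed

lemma reps_joined:
  assumes "i < n"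
  shows "node i 0 L \<sim> top_rep i" and "node i (ps ! i) L \<sim> bottom_rep i"
proof -
  have "\<exists>k<n. node k 0 L \<sim> top_rep k \<and> node k (ps ! k) L \<sim> bottom_rep k"
  proof (cases some_straight)
    case True
    then obtain w where w: "w < n" "straight w" by (auto simp: some_straight_def)
    have "Suc w mod n < n" using n_pos by simp
    with w top_rep_step[of w] bottom_rep_step[of w] show ?thesis by blast
  next
    case False
    then have "\<not> straight 0" using n_pos by (auto simp: some_straight_def)
    then show ?thesis using False bottom_crossed[OF n_pos] n_pos
      by (auto simp: top_rep_def bottom_rep_def simp del: node_simps)
  qed
  then obtain k where k: "k < n" "node k 0 L \<sim> top_rep k" "node k (ps ! k) L \<sim> bottom_rep k"
    by blast
  show "node i 0 L \<sim> top_rep i"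
    by (rule cyclic_induct[where P = "\<lambda>i. node i 0 L \<sim> top_rep i", OF k(1,2) _ assms])
      (rule top_rep_step, auto simp del: node_simps)
  show "node i (ps ! i) L \<sim> bottom_rep i"
    by (rule cyclic_induct[where P = "\<lambda>i. node i (ps ! i) L \<sim> bottom_rep i", OF k(1,3) _ assms])
      (rule bottom_rep_step, auto simp del: node_simps)
qed

text \<open>
  The distinguished end of the curve through a node. Between two consecutive horizontally
  smoothed crossings of a column lies a small circle; it is represented by the lower left end
  of the upper one of these crossings.
\<close>

definition rep :: "nat \<Rightarrow> nat \<Rightarrow> side \<Rightarrow> (nat \<times> nat) \<times> corner" where
  "rep i l d =
     (if straight i then (if d = L then top_rep i else node i 0 R)
      else if \<forall>j<l. \<not> horizontal i j then top_rep i
      else if \<forall>j\<ge>l. \<not> horizontal i j then bottom_rep i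
      else node i (Suc (Max {j. j < l \<and> horizontal i j})) L)"

lemma node_joined_rep:
  assumes "i < n" "l \<le> ps ! i"
  shows "node i l d \<sim> rep i l d"
proof -
  note [simp del] = node_simps
  note join = reps_joined[OF assms(1)] straight_joined[OF assms(1) _ assms(2)]
  consider "straight i" | "\<not> straight i" "\<forall>j<l. \<not> horizontal i j"
    | "\<not> straight i" "\<exists>j<l. horizontal i j" "\<forall>j\<ge>l. \<not> horizontal i j"
    | "\<not> straight i" "\<exists>j<l. horizontal i j" "\<exists>j\<ge>l. horizontal i j" by blast
  then show ?thesis
  proof cases
    case 1
    then show ?thesis using join(1) join(3)[of d]
      by (cases d) (auto simp: rep_def intro: joined_trans)
  next
    case 2
    have "node i l d \<sim> node i 0 d"
      using 2 assms by (intro joined_sym[OF strand_joined]) auto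
    moreover have "node i 0 d \<sim> node i 0 L"
      using top_crossed[OF assms(1) 2(1)] by (cases d) (auto intro: joined_sym)
    ultimately have "node i l d \<sim> top_rep i" using join(1) by (meson joined_trans)
    then show ?thesis using 2 by (simp add: rep_def)
  next
    case 3
    have "node i l d \<sim> node i (ps ! i) d"
      using 3 assms by (intro strand_joined) auto
    moreover have "node i (ps ! i) d \<sim> node i (ps ! i) L"
      using bottom_crossed[OF assms(1) 3(1)] by (cases d) (auto intro: joined_sym)
    ultimately have "node i l d \<sim> bottom_rep i" using join(2) by (meson joined_trans)
    moreover have "rep i l d = bottom_rep i" using 3 by (auto simp: rep_def)
    ultimately show ?thesis by simp
  next
    case 4
    define j where "j = Max {j. j < l \<and> horizontal i j}"
    have "j \<in> {j. j < l \<and> horizontal i j}" unfolding j_def using 4 by (intro Max_in) auto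
    then have j: "j < l" "horizontal i j" by auto
    have above: "\<not> horizontal i j'" if "Suc j \<le> j'" "j' < l" for j'
    proof
      assume "horizontal i j'"
      then have "j' \<le> j" unfolding j_def using that by (intro Max_ge) auto
      with that show False by simp
    qed
    have "node i l d \<sim> node i (Suc j) d"
      using j above assms by (intro joined_sym[OF strand_joined]) auto
    moreover have "node i (Suc j) d \<sim> node i (Suc j) L"
      using horizontal_joined(2)[OF assms(1) j(2)] by (cases d) (auto intro: joined_sym)
    ultimately have "node i l d \<sim> node i (Suc j) L" by (meson joined_trans)
    moreover have "rep i l d = node i (Suc j) L" using 4 unfolding rep_def j_def by meson
    ultimately show ?thesis by simp
  qed
qed

fun end_rep :: "(nat \<times> nat) \<times> corner \<Rightarrow> (nat \<times> nat) \<times> corner" where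
  "end_rep ((i, j), UL) = rep i j L"
| "end_rep ((i, j), UR) = rep i j R"
| "end_rep ((i, j), LL) = rep i (Suc j) L"
| "end_rep ((i, j), LR) = rep i (Suc j) R"

lemma end_rep_upper: "end_rep ((i, j), upper d) = rep i j d" by (cases d) auto
lemma end_rep_lower: "end_rep ((i, j), lower d) = rep i (Suc j) d" by (cases d) auto

lemma end_rep_node [simp]: "end_rep (node i l d) = rep i l d"
  by (cases l) (auto simp: end_rep_upper end_rep_lower)

lemma end_cases:
  obtains i j d where "x = ((i, j), upper d)" | i j d where "x = ((i, j), lower d)"
proof -
  obtain i j k where "x = ((i, j), k)" by (metis surj_pair)
  then show thesis using that by (cases k) (metis upper.simps lower.simps)+
qed

lemma end_joined_rep:
  assumes "x \<in> ends (pretzel ps)"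
  shows "x \<sim> end_rep x"
proof (cases x rule: end_cases)
  case (1 i j d)
  with assms have ij: "i < n" "j < ps ! i"
    by (auto simp: ends_def pretzel_def pretzel_crossings_def)
  show ?thesis using upper_end_joined[OF ij, of d] node_joined_rep[OF ij(1), of j d] ij 1
    by (auto simp: end_rep_upper intro: joined_trans)
next
  case (2 i j d)
  with assms have ij: "i < n" "j < ps ! i"
    by (auto simp: ends_def pretzel_def pretzel_crossings_def)
  show ?thesis using node_joined_rep[OF ij(1), of "Suc j" d] ij 2
    by (auto simp: end_rep_lower)
qed

lemma rep_top: "rep i 0 d = (if straight i \<and> d = R then node i 0 R else top_rep i)"
  by (cases d) (auto simp: rep_def)

lemma rep_bottom:
  assumes "i < n"
  shows "rep i (ps ! i) d = (if straight i \<and> d = R then node i 0 R else bottom_rep i)"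
proof -
  have "\<forall>j\<ge>ps ! i. \<not> horizontal i j" by (auto simp: horizontal_def)
  moreover have "\<exists>j<ps ! i. horizontal i j" if "\<not> straight i"
    using that by (auto simp: straight_def horizontal_def)
  ultimately show ?thesis using straight_reps_eq[OF assms]
    by (cases d) (auto simp: rep_def)
qed

lemma rep_vertical:
  assumes "\<not> horizontal i j"
  shows "rep i (Suc j) d = rep i j d"
proof -
  have "(\<forall>j'<Suc j. \<not> horizontal i j') \<longleftrightarrow> (\<forall>j'<j. \<not> horizontal i j')"
    using assms by (auto simp: less_Suc_eq)
  moreover have "(\<forall>j'\<ge>Suc j. \<not> horizontal i j') \<longleftrightarrow> (\<forall>j'\<ge>j. \<not> horizontal i j')"
    using assms by (metis Suc_leD le_antisym not_less_eq_eq)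
  moreover have "{j'. j' < Suc j \<and> horizontal i j'} = {j'. j' < j \<and> horizontal i j'}"
    using assms by (auto simp: less_Suc_eq)
  ultimately show ?thesis by (simp only: rep_def)
qed

lemma rep_horizontal: "\<not> straight i \<Longrightarrow> rep i l L = rep i l R"
  by (simp add: rep_def)

text \<open>
  The arcs of a smoothed diagram preserve the representative. Column arcs connect two ends of the
  same node; for the joining and closing arcs this is the recurrence \<open>rep_step\<close>; vertical
  smoothings leave the representative unchanged, and horizontal ones occur in columns where the
  representative does not distinguish the two sides.
\<close>

lemma end_rep_smoothed_arc:
  assumes e: "e \<in> smoothed_arcs (pretzel ps) s" and x: "x \<in> e" and y: "y \<in> e"
  shows "end_rep x = end_rep y"
proof -
  have top: "rep i 0 R = rep (Suc i mod n) 0 L" if "i < n" for i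
    using that by (simp add: rep_top rep_step)
  have bottom: "rep i (ps ! i) R = rep (Suc i mod n) (ps ! (Suc i mod n)) L" if "i < n" for i
    using that n_pos by (simp add: rep_bottom rep_step)
  have wrap: "n - 1 < n" "Suc (n - 1) mod n = 0" using n_pos by auto
  have bot: "end_rep (bottom_crossing ps i, LL) = rep i (ps ! i) L"
    "end_rep (bottom_crossing ps i, LR) = rep i (ps ! i) R" if "i < n" for i
    using end_rep_node[of i "ps ! i" L] end_rep_node[of i "ps ! i" R] bottom_node[OF that]
    by simp_all
  from e consider "e \<in> column_arcs ps" | "e \<in> joining_arcs ps" | "e \<in> closing_arcs ps"
    | i j where "i < n" "j < ps ! i" "e \<in> smoothing_arcs (s (i, j)) (i, j)"
    by (auto simp: smoothed_arcs_def pretzel_def pretzel_crossings_def)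
  then show ?thesis
  proof cases
    case 1
    then show ?thesis using x y by (auto simp: column_arcs_def)
  next
    case 2
    then obtain i where i: "Suc i < n"
      and "e = {(top_crossing i, UR), (top_crossing (Suc i), UL)}
        \<or> e = {(bottom_crossing ps i, LR), (bottom_crossing ps (Suc i), LL)}"
      by (auto simp: joining_arcs_def)
    then show ?thesis using x y top[of i] bottom[of i] bot[of i] bot[of "Suc i"]
      by (auto simp: top_crossing_def)
  next
    case 3
    then show ?thesis using x y top[OF wrap(1)] bottom[OF wrap(1)] bot[OF wrap(1)] bot[OF n_pos]
      unfolding wrap(2) by (auto simp: closing_arcs_def top_crossing_def)
  next
    case 4
    show ?thesis
    proof (cases "horizontal i j")
      case True
      then have "\<not> straight i" by (auto simp: straight_def)
      then show ?thesis using 4 x y True rep_horizontal[of i j] rep_horizontal[of i "Suc j"]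
        by (auto simp: smoothing_arcs_def horizontal_def)
    next
      case False
      then show ?thesis using 4 x y sign_cases[OF 4(1,2) False] rep_vertical[OF False]
        by (auto simp: smoothing_arcs_def)
    qed
  qed
qed

text \<open>
  The values of \<open>end_rep\<close>: first the curves that run around the ring or between two consecutive
  straight columns, then the small circles. A small circle lies below each horizontally smoothed
  crossing except the last one in its column.
\<close>

definition ring_reps :: "((nat \<times> nat) \<times> corner) set" where
  "ring_reps = (if some_straight then (\<lambda>i. node i 0 R) ` {i. i < n \<and> straight i}
     else {node 0 0 L, node 0 (ps ! 0) R})"

definition inner_horizontal :: "nat \<Rightarrow> nat set" where
  "inner_horizontal i = {j. horizontal i j \<and> (\<exists>j'>j. horizontal i j')}"

definition inner_reps :: "((nat \<times> nat) \<times> corner) set" where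
  "inner_reps = (\<lambda>(i, j). node i (Suc j) L) ` (SIGMA i:{..<n}. inner_horizontal i)"

lemma reps_in_ring: "i < n \<Longrightarrow> top_rep i \<in> ring_reps" "i < n \<Longrightarrow> bottom_rep i \<in> ring_reps"
  using last_straight_in[of i] by (auto simp: top_rep_def bottom_rep_def ring_reps_def)

lemma rep_in:
  assumes "i < n"
  shows "rep i l d \<in> ring_reps \<union> inner_reps"
proof (cases "\<not> straight i \<and> (\<exists>j<l. horizontal i j) \<and> (\<exists>j\<ge>l. horizontal i j)")
  case True
  let ?j = "Max {j. j < l \<and> horizontal i j}"
  have "?j \<in> {j. j < l \<and> horizontal i j}" using True by (intro Max_in) auto
  then have "?j \<in> inner_horizontal i"
    using True unfolding inner_horizontal_def by (auto intro: less_le_trans)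
  moreover have "rep i l d = node i (Suc ?j) L" using True by (auto simp: rep_def)
  ultimately show ?thesis using assms by (force simp: inner_reps_def)
next
  case False
  then have "rep i l d \<in> {top_rep i, bottom_rep i} \<or> straight i \<and> rep i l d = node i 0 R"
    by (auto simp: rep_def)
  moreover have "node i 0 R \<in> ring_reps" if "straight i"
    using that assms by (auto simp: ring_reps_def some_straight_def)
  ultimately show ?thesis using reps_in_ring[OF assms] by auto
qed

lemma reps_fixed:
  assumes "x \<in> ring_reps \<union> inner_reps"
  shows "x \<in> ends (pretzel ps) \<and> end_rep x = x"
  using assms
proof
  have nd: "node i l d \<in> ends (pretzel ps)" if "i < n" "l \<le> ps ! i" for i l d
    using that positive[of i]
    by (cases l) (auto simp: ends_def pretzel_def pretzel_crossings_def)
  note [simp del] = node_simps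
  assume "x \<in> ring_reps"
  then consider i where "i < n" "straight i" "x = node i 0 R"
    | "\<not> some_straight" "x = node 0 0 L" | "\<not> some_straight" "x = node 0 (ps ! 0) R"
    by (auto simp: ring_reps_def split: if_splits)
  then show ?thesis
  proof cases
    case 1
    then show ?thesis by (simp add: nd rep_top)
  next
    case 2
    then show ?thesis using n_pos by (simp add: nd rep_top top_rep_def)
  next
    case 3
    then have "\<not> straight 0" using n_pos by (auto simp: some_straight_def)
    then show ?thesis using 3 n_pos by (simp add: nd rep_bottom bottom_rep_def)
  qed
next
  assume "x \<in> inner_reps"
  then obtain i j j' where ij: "i < n" "horizontal i j" "j < j'" "horizontal i j'" "x = node i (Suc j) L"
    by (auto simp: inner_reps_def inner_horizontal_def)
  have "Max {j'. j' < Suc j \<and> horizontal i j'} = j" using ij by (intro Max_eqI) auto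
  moreover have "\<not> straight i" "\<not> (\<forall>k<Suc j. \<not> horizontal i k)" "\<not> (\<forall>k\<ge>Suc j. \<not> horizontal i k)"
    using ij by (auto simp: straight_def Suc_le_eq)
  ultimately have "rep i (Suc j) L = node i (Suc j) L" by (simp only: rep_def if_False)
  moreover have "x \<in> ends (pretzel ps)"
    using ij by (auto simp: ends_def pretzel_def pretzel_crossings_def horizontal_def)
  ultimately show ?thesis using ij end_rep_node[of i "Suc j" L] by simp
qed

lemma end_rep_image: "end_rep ` ends (pretzel ps) = ring_reps \<union> inner_reps"
proof
  show "end_rep ` ends (pretzel ps) \<subseteq> ring_reps \<union> inner_reps"
  proof (rule image_subsetI)
    fix x assume x: "x \<in> ends (pretzel ps)"
    show "end_rep x \<in> ring_reps \<union> inner_reps"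
    proof (cases x rule: end_cases)
      case (1 i j d)
      then show ?thesis using x rep_in[of i j d]
        by (simp add: ends_def pretzel_def pretzel_crossings_def end_rep_upper)
    next
      case (2 i j d)
      then show ?thesis using x rep_in[of i "Suc j" d]
        by (simp add: ends_def pretzel_def pretzel_crossings_def end_rep_lower)
    qed
  qed
  show "ring_reps \<union> inner_reps \<subseteq> end_rep ` ends (pretzel ps)"
  proof
    fix x assume "x \<in> ring_reps \<union> inner_reps"
    from reps_fixed[OF this] show "x \<in> end_rep ` ends (pretzel ps)" by force
  qed
qed

lemma card_inner_horizontal: "card (inner_horizontal i) = card {j. horizontal i j} - 1"
proof (cases "straight i")
  case True
  then show ?thesis by (simp add: inner_horizontal_def straight_def)
next
  case False
  let ?M = "{j. horizontal i j}"
  have M: "Max ?M \<in> ?M" using False finite_horizontal[of i] by (intro Max_in) (auto simp: straight_def)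
  have "inner_horizontal i = ?M - {Max ?M}"
  proof (intro equalityI subsetI)
    fix j assume "j \<in> inner_horizontal i"
    then obtain j' where "horizontal i j" "j < j'" "horizontal i j'" by (auto simp: inner_horizontal_def)
    moreover have "j' \<le> Max ?M" using \<open>horizontal i j'\<close> finite_horizontal[of i] by (intro Max_ge) auto
    ultimately show "j \<in> ?M - {Max ?M}" by auto
  next
    fix j assume j: "j \<in> ?M - {Max ?M}"
    then have "j \<le> Max ?M" using finite_horizontal[of i] by (intro Max_ge) auto
    with j M show "j \<in> inner_horizontal i"
      unfolding inner_horizontal_def by (auto intro!: exI[of _ "Max ?M"])
  qed
  then show ?thesis using M finite_horizontal[of i] by (simp add: card_Diff_singleton)
qed

theorem num_curves_pretzel:
  "num_curves (pretzel ps) s =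
     (if some_straight then card {i. i < n \<and> straight i} else 2)
       + (\<Sum>i<n. card {j. horizontal i j} - 1)"
proof -
  have "num_curves (pretzel ps) s = card (end_rep ` ends (pretzel ps))"
  proof -
    have "card (ends (pretzel ps) // (link\<^sup>* \<inter> ends (pretzel ps) \<times> ends (pretzel ps)))
        = card (end_rep ` ends (pretzel ps))"
    proof (rule card_quotient_rtrancl_retract[OF sym_link])
      show "end_rep ` ends (pretzel ps) \<subseteq> ends (pretzel ps)"
        unfolding end_rep_image using reps_fixed by blast
      show "end_rep x = end_rep y" if "(x, y) \<in> link" for x y
        using that end_rep_smoothed_arc[of "{x, y}"] by (auto simp: link_def)
    qed (rule end_joined_rep)
    then show ?thesis by (simp add: num_curves_def same_curve_def link_def pretzel_def)
  qed
  also have "\<dots> = card ring_reps + card inner_reps"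
    unfolding end_rep_image
  proof (rule card_Un_disjoint)
    have fin: "finite (inner_horizontal i)" for i
      by (rule finite_subset[OF _ finite_horizontal[of i]]) (auto simp: inner_horizontal_def)
    show "finite ring_reps" "finite inner_reps"
      using fin by (auto simp: ring_reps_def inner_reps_def)
    show "ring_reps \<inter> inner_reps = {}"
      using bottom_node[OF n_pos, of R]
      by (auto simp: ring_reps_def inner_reps_def split: if_splits)
  qed
  also have "card ring_reps = (if some_straight then card {i. i < n \<and> straight i} else 2)"
    using bottom_node[OF n_pos, of R]
    by (auto simp: ring_reps_def card_image inj_on_def)
  also have "card inner_reps = (\<Sum>i<n. card {j. horizontal i j} - 1)"
  proof -
    have fin: "finite (inner_horizontal i)" for i
      by (rule finite_subset[OF _ finite_horizontal[of i]]) (auto simp: inner_horizontal_def)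
    have "card inner_reps = card (SIGMA i:{..<n}. inner_horizontal i)"
      unfolding inner_reps_def by (rule card_image) (auto simp: inj_on_def)
    also have "\<dots> = (\<Sum>i<n. card (inner_horizontal i))" using fin by (simp add: card_SigmaI)
    finally show ?thesis by (simp add: card_inner_horizontal)
  qed
  finally show ?thesis .
qed

end

section \<open>The state sum of a pretzel diagram\<close>

text \<open>
  A state of the whole diagram is a family of states of the columns. Hence a sum over states of a
  product of column weights is the product of the sums over column states.
\<close>

lemma sum_PiE_Sigma_prod:
  fixes h :: "'i \<Rightarrow> ('j \<Rightarrow> 'a) \<Rightarrow> 'b::comm_semiring_1"
  assumes "finite I" "\<And>i. finite (J i)" "finite T"
  shows "(\<Sum>s\<in>Sigma I J \<rightarrow>\<^sub>E T. \<Prod>i\<in>I. h i (\<lambda>j\<in>J i. s (i, j)))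
    = (\<Prod>i\<in>I. \<Sum>t\<in>J i \<rightarrow>\<^sub>E T. h i t)"
proof -
  have "(\<Prod>i\<in>I. \<Sum>t\<in>J i \<rightarrow>\<^sub>E T. h i t)
      = (\<Sum>g\<in>(\<Pi>\<^sub>E i\<in>I. J i \<rightarrow>\<^sub>E T). \<Prod>i\<in>I. h i (g i))"
    using assms by (intro prod_sum_PiE finite_PiE)
  also have "\<dots> = (\<Sum>s\<in>Sigma I J \<rightarrow>\<^sub>E T. \<Prod>i\<in>I. h i (\<lambda>j\<in>J i. s (i, j)))"
    by (rule sum.reindex_bij_witness[where i = "\<lambda>s. \<lambda>i\<in>I. \<lambda>j\<in>J i. s (i, j)"
          and j = "\<lambda>g. \<lambda>(i, j)\<in>Sigma I J. g i j"])
      (auto simp: PiE_iff extensional_def fun_eq_iff restrict_def intro!: prod.cong arg_cong2[where f = h])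
  finally show ?thesis ..
qed

lemma powi_sum:
  fixes x :: "'a::field"
  assumes "x \<noteq> 0"
  shows "x powi (\<Sum>a\<in>S. f a) = (\<Prod>a\<in>S. x powi f a)"
  using assms by (induction S rule: infinite_finite_induct) (auto simp: power_int_add)

lemma indet_nonzero: "\<A> \<noteq> 0"
  by (simp add: indet_def Zero_fract_def eq_fract)

text \<open>
  A zero of \<open>\<delta>\<close> would give \<open>A\<^sup>4 + 1 = 0\<close>, but the polynomial \<open>x\<^sup>4 + 1\<close> has the value \<open>1\<close> at \<open>0\<close>.
\<close>

lemma loop_value_nonzero: "\<delta> \<noteq> 0"
proof
  assume "\<delta> = 0"
  then have "\<A> ^ 4 + 1 = 0"
    using indet_nonzero by (simp add: loop_value_def field_simps power_int_minus eval_nat_numeral)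
  moreover have "\<A> ^ 4 + 1 = Fraction_Field.Fract ([:0, 1:] ^ 4 + 1) 1"
    by (simp add: indet_def eval_nat_numeral One_fract_def)
  ultimately have "([:0, 1:] ^ 4 + 1 :: rat poly) = 0"
    by (simp add: Zero_fract_def eq_fract)
  then have "poly ([:0, 1:] ^ 4 + 1 :: rat poly) 0 = 0" by simp
  then show False by simp
qed

text \<open>
  The parameter \<open>c\<close> is the factor given to a column of two vertical strands: \<open>\<delta>\<close> in the
  factorised state sum, and \<open>0\<close> in its correction, where only states without such
  columns are to be seen.
\<close>

definition column_weight :: "rat poly fract \<Rightarrow> nat \<Rightarrow> (nat \<Rightarrow> int) \<Rightarrow> rat poly fract" where
  "column_weight c p t = \<A> powi (\<Sum>j<p. t j) *
     (if \<forall>j<p. t j = 1 then c else \<delta> ^ (card {j. j < p \<and> t j = - 1} - 1))"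

text \<open>
  If the weight of the all-plus state is replaced by \<open>A\<^sup>p\<close> and all the others are multiplied by
  \<open>\<delta>\<close>, the weights become products over the crossings, and their sum is
  \<open>(A + A\<^sup>-\<^sup>1 \<delta>)\<^sup>p = A\<^sup>p (F\<^sub>p + 1)\<close>.
\<close>

lemma sum_column_weight:
  "(\<Sum>t\<in>{..<p} \<rightarrow>\<^sub>E {- 1, 1}. column_weight c p t) = \<A> ^ p * (F p / \<delta> + c)"
proof -
  let ?T = "{..<p} \<rightarrow>\<^sub>E {- 1, 1 :: int}"
  let ?one = "\<lambda>j\<in>{..<p}. 1 :: int"
  let ?k = "\<lambda>t. card {j. j < p \<and> t j = (- 1 :: int)}"
  define w where "w t = \<A> powi (\<Sum>j<p. t j) * \<delta> ^ ?k t" for t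
  have "(\<Sum>t\<in>?T. w t) = (\<Sum>t\<in>?T. \<Prod>j<p. \<A> powi t j * (if t j = - 1 then \<delta> else 1))"
  proof (rule sum.cong[OF refl])
    fix t :: "nat \<Rightarrow> int"
    have "{j \<in> {..<p}. t j = - 1} = {j. j < p \<and> t j = - 1}" by auto
    then have "(\<Prod>j<p. if t j = - 1 then \<delta> else 1) = \<delta> ^ ?k t"
      by (simp add: prod.inter_filter[symmetric])
    then show "w t = (\<Prod>j<p. \<A> powi t j * (if t j = - 1 then \<delta> else 1))"
      by (simp add: w_def prod.distrib powi_sum indet_nonzero)
  qed
  also have "\<dots> = (\<Prod>j<p. \<Sum>x\<in>{- 1, 1}. \<A> powi x * (if x = - 1 then \<delta> else 1))"
    by (rule prod_sum_PiE[symmetric]) auto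
  also have "(\<Sum>x\<in>{- 1, 1}. \<A> powi x * (if x = - 1 then \<delta> else 1)) = \<A> * (- (\<A> powi (- 4)))"
    using indet_nonzero
    by (simp add: loop_value_def power_int_minus field_simps eval_nat_numeral)
  finally have sum_w: "(\<Sum>t\<in>?T. w t) = \<A> ^ p * (F p + 1)"
    by (simp add: F_def power_mult_distrib[symmetric])
  have one: "?one \<in> ?T" by auto
  have fin: "finite ?T" by (intro finite_PiE) auto
  have w_one: "w ?one = \<A> ^ p" by (simp add: w_def)
  have weight_one: "column_weight c p ?one = \<A> ^ p * c" by (simp add: column_weight_def)
  have weight: "column_weight c p t = w t / \<delta>" if t: "t \<in> ?T - {?one}" for t
  proof -
    have "\<exists>j<p. t j \<noteq> 1"
    proof (rule ccontr)
      assume "\<not> (\<exists>j<p. t j \<noteq> 1)"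
      then have "t = ?one" using t by (intro ext) (auto simp: PiE_iff extensional_def)
      then show False using t by simp
    qed
    then obtain j where j: "j < p" "t j = - 1" using t by (auto simp: PiE_iff)
    then have "?k t \<noteq> 0" by auto
    then obtain k where "?k t = Suc k" using not0_implies_Suc by blast
    with j show ?thesis using loop_value_nonzero by (auto simp: column_weight_def w_def)
  qed
  have "(\<Sum>t\<in>?T. column_weight c p t)
      = \<A> ^ p * c + (\<Sum>t\<in>?T - {?one}. w t / \<delta>)"
    using weight by (simp add: sum.remove[OF fin one] weight_one)
  also have "(\<Sum>t\<in>?T - {?one}. w t / \<delta>) = ((\<Sum>t\<in>?T. w t) - w ?one) / \<delta>"
    by (simp add: sum_divide_distrib[symmetric] sum.remove[OF fin one])
  finally show ?thesis by (simp add: sum_w w_one algebra_simps diff_divide_distrib)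
qed

context pretzel_state
begin

text \<open>
  Straight columns contribute \<open>\<delta>\<^sup>v\<close> to the first product. For \<open>v > 0\<close> the second product vanishes
  and the factor \<open>1 / \<delta>\<close> matches the exponent in the bracket. For \<open>v = 0\<close> the two products agree,
  and their coefficients add up to \<open>\<delta>\<close>, as two ring curves require.
\<close>

lemma state_bracket_columns:
  "state_bracket (pretzel ps) s =
     (\<Prod>i<n. column_weight \<delta> (ps ! i) (\<lambda>j\<in>{..<ps ! i}. s (i, j))) / \<delta>
     + (\<delta> - 1 / \<delta>) * (\<Prod>i<n. column_weight 0 (ps ! i) (\<lambda>j\<in>{..<ps ! i}. s (i, j)))"
proof -
  let ?t = "\<lambda>i. \<lambda>j\<in>{..<ps ! i}. s (i, j)"
  let ?S = "{i. i < n \<and> straight i}"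
  let ?K = "\<Sum>i<n. card {j. horizontal i j} - 1"
  define a where "a = \<A> powi (\<Sum>c\<in>crossings (pretzel ps). s c)"
  have crossings: "crossings (pretzel ps) = (SIGMA i:{..<n}. {..<ps ! i})"
    by (auto simp: pretzel_def pretzel_crossings_def)
  have a: "a = (\<Prod>i<n. \<A> powi (\<Sum>j<ps ! i. ?t i j))"
    unfolding a_def crossings by (simp add: powi_sum indet_nonzero prod.Sigma)
  have all_plus: "(\<forall>j<ps ! i. ?t i j = 1) \<longleftrightarrow> straight i" if "i < n" for i
    using sign_cases[OF that] by (auto simp: straight_def horizontal_def)
  have horizontals: "{j. j < ps ! i \<and> ?t i j = - 1} = {j. horizontal i j}" for i
    by (auto simp: horizontal_def)
  have no_horizontal: "card {j. horizontal i j} = 0" if "straight i" for i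
    using that by (simp add: straight_def)
  have columns: "(\<Prod>i<n. column_weight c (ps ! i) (?t i))
      = a * (\<Prod>i<n. if straight i then c else 1) * \<delta> ^ ?K" for c
  proof -
    have "column_weight c (ps ! i) (?t i) = \<A> powi (\<Sum>j<ps ! i. ?t i j)
        * ((if straight i then c else 1) * \<delta> ^ (card {j. horizontal i j} - 1))" if "i < n" for i
      using all_plus[OF that] no_horizontal[of i]
      unfolding column_weight_def horizontals by (cases "straight i") auto
    then have "(\<Prod>i<n. column_weight c (ps ! i) (?t i)) = (\<Prod>i<n. \<A> powi (\<Sum>j<ps ! i. ?t i j)
        * ((if straight i then c else 1) * \<delta> ^ (card {j. horizontal i j} - 1)))"
      by (intro prod.cong) auto
    then show ?thesis unfolding a by (simp only: prod.distrib power_sum mult.assoc)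
  qed
  have straights: "(\<Prod>i<n. if straight i then c else 1) = c ^ card ?S" for c :: "rat poly fract"
  proof -
    have "{i \<in> {..<n}. straight i} = ?S" by auto
    then show ?thesis by (simp add: prod.inter_filter[symmetric])
  qed
  have bracket: "state_bracket (pretzel ps) s = a * \<delta> ^ num_curves (pretzel ps) s / \<delta>"
    using loop_value_nonzero by (simp add: state_bracket_def a_def power_int_diff)
  show ?thesis
  proof (cases some_straight)
    case True
    then have "card ?S \<noteq> 0" by (auto simp: some_straight_def)
    then have zero: "(0 :: rat poly fract) ^ card ?S = 0" by (simp only: power_0_left if_False)
    show ?thesis using True
      by (simp add: bracket columns straights num_curves_pretzel power_add zero)
  next
    case False
    then have "card ?S = 0" by (auto simp: some_straight_def)
    then show ?thesis using False loop_value_nonzero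
      by (simp add: bracket columns straights num_curves_pretzel field_simps power2_eq_square)
  qed
qed

end

theorem kauffman_bracket_pretzel:
  assumes ne: "ps \<noteq> []" and pos: "\<And>p. p \<in> set ps \<Longrightarrow> 0 < p"
  shows "kauffman_bracket (pretzel ps) = \<A> ^ sum_list ps *
    (prod_list (map (\<lambda>p. F p / \<delta> + \<delta>) ps) / \<delta>
      + (\<delta> - 1 / \<delta>) * prod_list (map (\<lambda>p. F p / \<delta>) ps))"
proof -
  let ?n = "length ps"
  let ?W = "\<lambda>c. \<Sum>s\<in>states (pretzel ps).
    \<Prod>i<?n. column_weight c (ps ! i) (\<lambda>j\<in>{..<ps ! i}. s (i, j))"
  have states: "states (pretzel ps) = (SIGMA i:{..<?n}. {..<ps ! i}) \<rightarrow>\<^sub>E {- 1, 1}"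
    by (auto simp: states_def pretzel_def pretzel_crossings_def intro!: arg_cong2[where f = PiE])
  have W: "?W c = \<A> ^ sum_list ps * prod_list (map (\<lambda>p. F p / \<delta> + c) ps)" for c
  proof -
    have "?W c = (\<Prod>i<?n. \<Sum>t\<in>{..<ps ! i} \<rightarrow>\<^sub>E {- 1, 1}. column_weight c (ps ! i) t)"
      unfolding states by (rule sum_PiE_Sigma_prod) auto
    also have "\<dots> = (\<Prod>i<?n. \<A> ^ (ps ! i) * (F (ps ! i) / \<delta> + c))"
      by (simp add: sum_column_weight)
    also have "\<dots> = \<A> ^ (\<Sum>i<?n. ps ! i) * (\<Prod>i<?n. F (ps ! i) / \<delta> + c)"
      by (simp add: prod.distrib power_sum)
    finally show ?thesis
      by (simp add: sum_list_sum_nth prod.list_conv_set_nth atLeast0LessThan)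
  qed
  have "state_bracket (pretzel ps) s =
      (\<Prod>i<?n. column_weight \<delta> (ps ! i) (\<lambda>j\<in>{..<ps ! i}. s (i, j))) / \<delta>
      + (\<delta> - 1 / \<delta>) * (\<Prod>i<?n. column_weight 0 (ps ! i) (\<lambda>j\<in>{..<ps ! i}. s (i, j)))"
    if "s \<in> states (pretzel ps)" for s
  proof -
    interpret pretzel_state ps s
      using ne pos that by unfold_locales auto
    show ?thesis by (rule state_bracket_columns)
  qed
  then have "kauffman_bracket (pretzel ps) = ?W \<delta> / \<delta> + (\<delta> - 1 / \<delta>) * ?W 0"
    by (simp add: kauffman_bracket_def sum.distrib sum_divide_distrib sum_distrib_left)
  then show ?thesis unfolding W by (simp add: algebra_simps)
qed

section \<open>Columns of height one\<close>

lemma F_1: "F 1 / \<delta> = \<A> powi (- 2)"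
proof -
  have "\<A> powi (- 2) * \<delta> = F 1"
    using indet_nonzero by (simp add: F_def loop_value_def power_int_minus field_simps eval_nat_numeral)
  then show ?thesis using loop_value_nonzero by (simp add: field_simps)
qed

theorem theorem1p1:
  fixes a b c m :: nat
  assumes "a > 0" and "b > 0" and "c > 0" and "even m"
  shows "kauffman_bracket (pretzel_ones m [a, b, c]) =
    \<A> ^ (3 * m + a + b + c) * \<delta> powi (- 4) *
      ((F a + \<delta> ^ 2) * (F b + \<delta> ^ 2) * (F c + \<delta> ^ 2) +
       (- (\<A> powi (- 4))) ^ m * (\<delta> ^ 2 - 1) * F a * F b * F c)"
proof -
  have A: "\<A> \<noteq> 0" and d: "\<delta> \<noteq> 0" by (rule indet_nonzero loop_value_nonzero)+
  have straight_ones: "(- (\<A> ^ 2)) ^ m = \<A> ^ (2 * m)"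
    using \<open>even m\<close> by (simp add: power_mult)
  have "\<A> powi (- 2) = \<A> ^ 2 * \<A> powi (- 4)"
    using A by (simp add: power_int_minus field_simps eval_nat_numeral)
  then have capped_ones: "(\<A> powi (- 2)) ^ m = \<A> ^ (2 * m) * (- (\<A> powi (- 4))) ^ m"
    using \<open>even m\<close> by (simp add: power_mult_distrib power_mult)
  have one_straight: "\<A> powi (- 2) + \<delta> = - (\<A> ^ 2)" by (simp add: loop_value_def)
  have "kauffman_bracket (pretzel_ones m [a, b, c]) =
    \<A> ^ (m + (a + (b + c))) *
      ((- (\<A> ^ 2)) ^ m * ((F a / \<delta> + \<delta>) * (F b / \<delta> + \<delta>) * (F c / \<delta> + \<delta>)) / \<delta>
       + (\<delta> - 1 / \<delta>) * ((\<A> powi (- 2)) ^ m * (F a / \<delta> * (F b / \<delta>) * (F c / \<delta>))))"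
    unfolding pretzel_ones_def using assms
    by (subst kauffman_bracket_pretzel) (auto simp: F_1[simplified] one_straight sum_list_replicate mult.assoc)
  also have "\<dots> = \<A> ^ (m + (a + (b + c))) * \<A> ^ (2 * m) *
      ((F a / \<delta> + \<delta>) * (F b / \<delta> + \<delta>) * (F c / \<delta> + \<delta>) / \<delta>
       + (- (\<A> powi (- 4))) ^ m * (\<delta> - 1 / \<delta>) * (F a / \<delta> * (F b / \<delta>) * (F c / \<delta>)))"
    unfolding straight_ones capped_ones by (simp add: distrib_left ac_simps)
  also have "\<A> ^ (m + (a + (b + c))) * \<A> ^ (2 * m) = \<A> ^ (3 * m + a + b + c)"
    by (simp add: power_add[symmetric] algebra_simps)
  also have "(F a / \<delta> + \<delta>) * (F b / \<delta> + \<delta>) * (F c / \<delta> + \<delta>) / \<delta>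
      = \<delta> powi (- 4) * ((F a + \<delta> ^ 2) * (F b + \<delta> ^ 2) * (F c + \<delta> ^ 2))"
  proof -
    have "F x / \<delta> + \<delta> = (F x + \<delta> ^ 2) / \<delta>" for x
      using d by (simp add: add_divide_distrib power2_eq_square)
    then show ?thesis by (simp add: power_int_minus divide_simps eval_nat_numeral)
  qed
  also have "(- (\<A> powi (- 4))) ^ m * (\<delta> - 1 / \<delta>) * (F a / \<delta> * (F b / \<delta>) * (F c / \<delta>))
      = \<delta> powi (- 4) * ((- (\<A> powi (- 4))) ^ m * (\<delta> ^ 2 - 1) * F a * F b * F c)"
  proof -
    have "\<delta> - 1 / \<delta> = (\<delta> ^ 2 - 1) / \<delta>"
      using d by (simp add: diff_divide_distrib power2_eq_square)
    then show ?thesis by (simp add: power_int_minus divide_simps eval_nat_numeral)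
  qed
  finally show ?thesis by (simp only: distrib_left mult.assoc)
qed

end
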